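(* Let $x^\ast$ be a local minimizer of the constrained problem $$\min_{x\in\mathbb R^n} f(x)\quad\text{subject to } c_i(x)=0\ (i\in\mathcal E),\quad c_i(x)\ge 0\ (i\in\mathcal I).$$ Suppose that $f$ is differentiable at $x^\ast$, that all constraint functions $c_i$, $i\in\mathcal E\cup\mathcal I$, are continuously differentiable at $x^\ast$, and that either the linear independence constraint qualification (LICQ) or the linear constraint qualification holds at $x^\ast$. Then there are Lagrange multiplier vectors $\lambda^\ast\in\mathbb R^{\mathcal E}$ and $\mu^\ast\in\mathbb R^{\mathcal I}$ such that $$\begin{aligned} \nabla_x\mathcal L(x^\ast,\lambda^\ast,\mu^\ast)&=0,\\ c_i(x^\ast)&=0 &&\forall i\in\mathcal E,\\ c_i(x^\ast)&\ge 0 &&\forall i\in\mathcal I,\\ \mu_i^\ast&\ge 0 &&\forall i\in\mathcal I,\\ \mu_i^\ast c_i(x^\ast)&=0 &&\forall i\in\mathcal I. \end{aligned}$$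
   Context: Setting: $\mathcal E$ and $\mathcal I$ are disjoint finite index sets, and $f:\mathbb R^n\to\mathbb R$ and $c_i:\mathbb R^n\to\mathbb R$ ($i\in\mathcal E\cup\mathcal I$) are real-valued functions. The feasible set is $\Omega=\{x\in\mathbb R^n : c_i(x)=0\ \forall i\in\mathcal E,\ c_i(x)\ge 0\ \forall i\in\mathcal I\}$. A local minimizer of the problem is a point $x^\ast\in\Omega$ such that $f(x^\ast)\le f(x)$ for all $x\in\Omega$ in some neighborhood of $x^\ast$. "Continuously differentiable at $x^\ast$" means $C^1$ in a neighborhood of $x^\ast$. Lagrangian: $\mathcal L(x,\lambda,\mu)=f(x)-\sum_{i\in\mathcal E}\lambda_i c_i(x)-\sum_{i\in\mathcal I}\mu_i c_i(x)$. Active set: for feasible $x$, $\mathcal A(x)=\mathcal E\cup\{i\in\mathcal I : c_i(x)=0\}$. LICQ holds at $x$ if the family of active constraint gradients $(\nabla c_i(x))_{i\in\mathcal A(x)}$ is linearly independent. The linear constraint qualification holds at $x$ if all active constraints are (affine) linear functions: for every $i\in\mathcal A(x)$ there exist $a_i\in\mathbb R^n$ and $b_i\in\mathbb R$ such that $c_i(y)=a_i^\top y+b_i$ for all $y\in\mathbb R^n$. *)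

theory Defs
  imports "HOL-Analysis.Analysis"
begin

definition gradient :: "('a::real_inner \<Rightarrow> real) \<Rightarrow> 'a \<Rightarrow> 'a" where
  "gradient f x = (THE D. GDERIV f x :> D)"

text \<open>The value of \<open>gradient f x\<close> is unspecified when \<open>f\<close> is not differentiable at \<open>x\<close>.
  The next two facts show that it is the gradient otherwise.\<close>

lemma gradient_eq:
  assumes "GDERIV f x :> D"
  shows "gradient f x = D"
proof -
  have "D' = D" if "GDERIV f x :> D'" for D'
  proof -
    have "(\<lambda>h. h \<bullet> D') = (\<lambda>h. h \<bullet> D)"
      using that assms has_derivative_unique unfolding gderiv_def by blast
    then show ?thesis
      by (metis vector_eq_ldot)
  qed
  with assms show ?thesis
    unfolding gradient_def by blast
qed

lemma gderiv_gradient: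
  fixes f :: "'a::euclidean_space \<Rightarrow> real"
  assumes "f differentiable (at x)"
  shows "GDERIV f x :> gradient f x"
proof -
  obtain f' where f': "(f has_derivative f') (at x)"
    using assms unfolding differentiable_def by blast
  then have lin: "linear f'"
    by (rule has_derivative_linear)
  have "f' = (\<lambda>h. h \<bullet> adjoint f' 1)"
    using adjoint_works[OF lin] by fastforce
  with f' have "GDERIV f x :> adjoint f' 1"
    unfolding gderiv_def by simp
  then show ?thesis
    using gradient_eq by metis
qed

definition C1_at :: "('a::real_inner \<Rightarrow> real) \<Rightarrow> 'a \<Rightarrow> bool" where
  "C1_at f x \<longleftrightarrow> (\<exists>U. open U \<and> x \<in> U \<and> (\<forall>y\<in>U. f differentiable (at y)) \<and>
     continuous_on U (gradient f))"

definition feasible_set ::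
  "('i \<Rightarrow> 'a \<Rightarrow> real) \<Rightarrow> 'i set \<Rightarrow> 'i set \<Rightarrow> 'a set" where
  "feasible_set c E I = {x. (\<forall>i\<in>E. c i x = 0) \<and> (\<forall>i\<in>I. c i x \<ge> 0)}"

definition local_minimizer_on ::
  "('a::topological_space \<Rightarrow> real) \<Rightarrow> 'a set \<Rightarrow> 'a \<Rightarrow> bool" where
  "local_minimizer_on f S x \<longleftrightarrow>
     x \<in> S \<and> (\<exists>U. open U \<and> x \<in> U \<and> (\<forall>y\<in>S \<inter> U. f x \<le> f y))"

definition lagrangian ::
  "('a \<Rightarrow> real) \<Rightarrow> ('i \<Rightarrow> 'a \<Rightarrow> real) \<Rightarrow> 'i set \<Rightarrow> 'i set \<Rightarrow> 'a \<Rightarrow> ('i \<Rightarrow> real) \<Rightarrow> ('i \<Rightarrow> real) \<Rightarrow> real" where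
  "lagrangian f c E I x lam mu =
     f x - (\<Sum>i\<in>E. lam i * c i x) - (\<Sum>i\<in>I. mu i * c i x)"

definition active_set ::
  "('i \<Rightarrow> 'a \<Rightarrow> real) \<Rightarrow> 'i set \<Rightarrow> 'i set \<Rightarrow> 'a \<Rightarrow> 'i set" where
  "active_set c E I x = E \<union> {i\<in>I. c i x = 0}"

text \<open>The library predicate \<open>independent\<close> is about sets of vectors. Injectivity is needed
  in addition to get independence of the indexed family: two active constraints
  with equal gradients violate LICQ.\<close>

definition LICQ ::
  "('i \<Rightarrow> 'a::euclidean_space \<Rightarrow> real) \<Rightarrow> 'i set \<Rightarrow> 'i set \<Rightarrow> 'a \<Rightarrow> bool" where
  "LICQ c E I x \<longleftrightarrow>
     inj_on (\<lambda>i. gradient (c i) x) (active_set c E I x) \<and>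
     independent ((\<lambda>i. gradient (c i) x) ` active_set c E I x)"

definition linear_CQ ::
  "('i \<Rightarrow> 'a::euclidean_space \<Rightarrow> real) \<Rightarrow> 'i set \<Rightarrow> 'i set \<Rightarrow> 'a \<Rightarrow> bool" where
  "linear_CQ c E I x \<longleftrightarrow>
     (\<forall>i\<in>active_set c E I x. \<exists>a b. \<forall>y. c i y = a \<bullet> y + b)"

end

theory Submission
  imports Defs
begin

text \<open>
  Each constraint qualification makes the linearization of the active constraints honest: for
  every direction \<open>d\<close> there is an arc through \<open>xs\<close> with velocity \<open>d\<close> along which every active
  constraint equals its linearization exactly, \<open>c i (y t) = t * (gradient (c i) xs \<bullet> d)\<close> for small
  \<open>t\<close>. Under the linear constraint qualification the arc is the line \<open>xs + t *\<^sub>R d\<close>. Under LICQ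
  the active gradients extend to a basis \<open>B\<close> of the space, and with each added basis vector \<open>b\<close>
  goes the linear function \<open>y \<mapsto> b \<bullet> y\<close>. By the inverse function theorem these functions together
  are local coordinates (\<open>exists_arc_with_linear_coordinates\<close>), so the arc is the straight line in
  these coordinates.

  If moreover \<open>d\<close> satisfies the linearized constraints, the arc is feasible for small \<open>t \<ge> 0\<close>, and
  \<open>f\<close> cannot decrease along it; hence \<open>gradient f xs \<bullet> d \<ge> 0\<close>. So no \<open>d\<close> separates \<open>gradient f xs\<close>
  from the cone that the active gradients generate (with both signs for equality constraints).
  This cone is finitely generated, hence closed, and therefore contains \<open>gradient f xs\<close> (the
  Farkas lemma \<open>farkas_mixed\<close>). The coefficients of a representation are the multipliers;
  inactive constraints get the multiplier zero, which is complementary slackness.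
\<close>

section \<open>The Farkas lemma\<close>

text \<open>Adding \<open>- a i\<close> for \<open>i \<in> E\<close> to the generators frees the sign of the coefficients on \<open>E\<close>
  and reduces the claim to membership in a finitely generated convex cone. Such
  cones are closed, so a point outside is strictly separated from the cone; on a cone a linear
  functional that is bounded below is nonnegative, which makes the separating normal violate
  the hypothesis.\<close>

lemma farkas_mixed:
  fixes a :: "'i \<Rightarrow> 'a::euclidean_space"
  assumes fin: "finite E" "finite J"
    and dual: "\<And>d. (\<And>i. i \<in> E \<Longrightarrow> a i \<bullet> d = 0) \<Longrightarrow> (\<And>i. i \<in> J \<Longrightarrow> a i \<bullet> d \<ge> 0) \<Longrightarrow> g \<bullet> d \<ge> 0"
  shows "\<exists>lam mu :: 'i \<Rightarrow> real. (\<forall>i\<in>J. mu i \<ge> 0) \<and>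
    g = (\<Sum>i\<in>E. lam i *\<^sub>R a i) + (\<Sum>i\<in>J. mu i *\<^sub>R a i)"
proof -
  define S where "S = a ` E \<union> (\<lambda>i. - a i) ` E \<union> a ` J"
  define comb where "comb lam mu = (\<Sum>i\<in>E. lam i *\<^sub>R a i) + (\<Sum>i\<in>J. mu i *\<^sub>R a i)"
    for lam mu :: "'i \<Rightarrow> real"
  define K where "K = {comb lam mu | lam mu. \<forall>i\<in>J. mu i \<ge> 0}"
  have K: "comb lam mu \<in> K" if "\<And>i. i \<in> J \<Longrightarrow> mu i \<ge> 0" for lam mu
    using that unfolding K_def by blast
  have comb_add: "comb l m + comb l' m' = comb (\<lambda>i. l i + l' i) (\<lambda>i. m i + m' i)" for l m l' m'
    by (simp add: comb_def scaleR_left_distrib sum.distrib)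
  have comb_scaleR: "r *\<^sub>R comb l m = comb (\<lambda>i. r * l i) (\<lambda>i. r * m i)" for r l m
    by (simp add: comb_def scaleR_right_distrib scaleR_sum_right)
  have single: "(\<Sum>i\<in>T. (if i = k then r else 0) *\<^sub>R a i) = r *\<^sub>R a k" if "finite T" "k \<in> T" for T k r
    using that by (simp add: if_distrib[of "\<lambda>s. s *\<^sub>R _"] sum.delta cong: if_cong)
  have "convex_cone K"
    unfolding convex_cone_iff
  proof (intro conjI ballI allI impI)
    have "comb (\<lambda>_. 0) (\<lambda>_. 0) \<in> K" by (rule K) simp
    then show "0 \<in> K" by (simp add: comb_def)
  next
    fix x y assume "x \<in> K" "y \<in> K"
    then obtain l m l' m' where "x = comb l m" "y = comb l' m'"
      and "\<forall>i\<in>J. m i \<ge> 0" "\<forall>i\<in>J. m' i \<ge> 0"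
      unfolding K_def by blast
    then show "x + y \<in> K" by (auto simp: comb_add intro: K)
  next
    fix x and r :: real assume "x \<in> K" "0 \<le> r"
    then obtain l m where "x = comb l m" "\<forall>i\<in>J. m i \<ge> 0"
      unfolding K_def by blast
    with \<open>0 \<le> r\<close> show "r *\<^sub>R x \<in> K" by (auto simp: comb_scaleR intro: K)
  qed
  moreover have "S \<subseteq> K"
  proof
    fix x assume "x \<in> S"
    then consider k r where "k \<in> E" "x = r *\<^sub>R a k" | k where "k \<in> J" "x = a k"
      unfolding S_def by (metis (no_types, lifting) UnE imageE scaleR_minus1_left scaleR_one)
    then show "x \<in> K"
    proof cases
      case (1 k r)
      have "comb (\<lambda>i. if i = k then r else 0) (\<lambda>_. 0) \<in> K" by (rule K) simp
      then show ?thesis using 1 single[OF fin(1)] by (simp add: comb_def)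
    next
      case (2 k)
      have "comb (\<lambda>_. 0) (\<lambda>i. if i = k then 1 else 0) \<in> K" by (rule K) simp
      then show ?thesis using 2 single[OF fin(2), of k 1] by (simp add: comb_def)
    qed
  qed
  ultimately have hull_K: "convex_cone hull S \<subseteq> K"
    by (simp add: hull_minimal)
  have "g \<in> convex_cone hull S"
  proof (rule ccontr)
    assume "g \<notin> convex_cone hull S"
    moreover have "closed (convex_cone hull S)"
      by (rule closed_convex_cone_hull) (simp add: S_def fin)
    ultimately obtain d b where sep: "d \<bullet> g < b" "\<And>x. x \<in> convex_cone hull S \<Longrightarrow> b < d \<bullet> x"
      using separating_hyperplane_closed_point[OF convex_convex_cone_hull] by metis
    have "b < 0" using sep(2)[OF convex_cone_hull_contains_0] by simp
    have nonneg: "0 \<le> d \<bullet> x" if x: "x \<in> S" for x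
    proof (rule ccontr)
      assume "\<not> 0 \<le> d \<bullet> x"
      then have neg: "d \<bullet> x < 0" by simp
      \<comment> \<open>the multiple of \<open>x\<close> lying on the separating hyperplane\<close>
      have "(b / (d \<bullet> x)) *\<^sub>R x \<in> convex_cone hull S"
        using neg \<open>b < 0\<close> by (intro convex_cone_hull_mul hull_inc x) (simp add: divide_nonpos_neg)
      from sep(2)[OF this] neg show False by simp
    qed
    have "g \<bullet> d \<ge> 0"
    proof (rule dual)
      fix i assume "i \<in> E"
      then have "0 \<le> d \<bullet> a i" "0 \<le> d \<bullet> (- a i)"
        by (auto intro!: nonneg simp del: inner_minus_right simp: S_def)
      then show "a i \<bullet> d = 0" by (simp add: inner_commute)
    next
      fix i assume "i \<in> J"
      then show "a i \<bullet> d \<ge> 0"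
        using nonneg[of "a i"] by (simp add: S_def inner_commute)
    qed
    with sep(1) \<open>b < 0\<close> show False by (simp add: inner_commute)
  qed
  with hull_K have "g \<in> K" ..
  then show ?thesis
    unfolding K_def comb_def by blast
qed

section \<open>Arcs along which given functions are linear\<close>

text \<open>The map \<open>F y = (\<Sum>b\<in>B. \<phi> b y *\<^sub>R b)\<close> is a local diffeomorphism at \<open>x\<close>: its derivative
  \<open>h \<mapsto> (\<Sum>b\<in>B. (b \<bullet> h) *\<^sub>R b)\<close> is injective because its inner product with \<open>h\<close> is the sum of
  the squares \<open>(b \<bullet> h)\<^sup>2\<close>. Pull back the line through \<open>F x\<close> with velocity \<open>F' d\<close>; independence of
  \<open>B\<close> turns the vector equation for \<open>F\<close> into one equation for each \<open>\<phi> b\<close>.\<close>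

lemma exists_arc_with_linear_coordinates:
  fixes x d :: "'a::euclidean_space"
  assumes indep: "independent B" and span: "span B = UNIV"
    and C1: "\<And>b. b \<in> B \<Longrightarrow> C1_at (\<phi> b) x"
    and grad: "\<And>b. b \<in> B \<Longrightarrow> gradient (\<phi> b) x = b"
  obtains y :: "real \<Rightarrow> 'a"
  where "y 0 = x" and "(y has_vector_derivative d) (at 0)"
    and "eventually (\<lambda>t. \<forall>b\<in>B. \<phi> b (y t) = \<phi> b x + t * (b \<bullet> d)) (nhds 0)"
proof -
  have finB: "finite B" using indep by (rule independent_imp_finite)
  obtain U where U: "\<And>b. b \<in> B \<Longrightarrow> open (U b)" "\<And>b. b \<in> B \<Longrightarrow> x \<in> U b"
      "\<And>b y. b \<in> B \<Longrightarrow> y \<in> U b \<Longrightarrow> \<phi> b differentiable (at y)"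
      "\<And>b. b \<in> B \<Longrightarrow> continuous_on (U b) (gradient (\<phi> b))"
    using C1 unfolding C1_at_def by metis
  define W where "W = (\<Inter>b\<in>B. U b)"
  have W: "open W" "x \<in> W"
    unfolding W_def using U finB by (auto intro: open_INT)
  define F where "F y = (\<Sum>b\<in>B. \<phi> b y *\<^sub>R b)" for y
  define F' where "F' y = (\<Sum>b\<in>B. blinfun_scaleR_left b o\<^sub>L blinfun_inner_right (gradient (\<phi> b) y))"
    for y
  have F'_apply: "blinfun_apply (F' y) h = (\<Sum>b\<in>B. (gradient (\<phi> b) y \<bullet> h) *\<^sub>R b)" for y h
    by (simp add: F'_def blinfun.sum_left)
  have F'_x: "blinfun_apply (F' x) h = (\<Sum>b\<in>B. (b \<bullet> h) *\<^sub>R b)" for h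
    unfolding F'_apply by (rule sum.cong) (simp_all add: grad)
  have derF: "(F has_derivative blinfun_apply (F' y)) (at y)" if "y \<in> W" for y
  proof -
    have "(\<phi> b has_derivative (\<lambda>h. gradient (\<phi> b) y \<bullet> h)) (at y)" if "b \<in> B" for b
      using gderiv_gradient[OF U(3)[OF that]] that \<open>y \<in> W\<close>
      by (simp add: W_def gderiv_def inner_commute)
    then have "(F has_derivative (\<lambda>h. \<Sum>b\<in>B. (gradient (\<phi> b) y \<bullet> h) *\<^sub>R b)) (at y)"
      unfolding F_def by (auto intro!: derivative_eq_intros)
    then show ?thesis by (simp add: F'_apply[abs_def])
  qed
  have contF': "continuous_on W F'"
    unfolding F'_def
  proof (intro continuous_intros bounded_linear.continuous_on[OF bounded_linear_blinfun_inner_right])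
    fix b assume b: "b \<in> B"
    show "continuous_on W (gradient (\<phi> b))"
      using U(4)[OF b] by (rule continuous_on_subset) (use b in \<open>auto simp: W_def\<close>)
  qed
  have inj: "inj (blinfun_apply (F' x))"
  proof -
    have "h = 0" if h: "blinfun_apply (F' x) h = 0" for h
    proof -
      have "(\<Sum>b\<in>B. (b \<bullet> h)\<^sup>2) = blinfun_apply (F' x) h \<bullet> h"
        by (simp add: F'_x inner_sum_left power2_eq_square)
      then have "\<forall>b\<in>B. orthogonal h b"
        using finB h by (simp add: sum_nonneg_eq_0_iff orthogonal_def inner_commute)
      then have "orthogonal h h"
        using orthogonal_to_span[of h B h] span by simp
      then show "h = 0" by (simp add: orthogonal_def)
    qed
    then show ?thesis
      by (subst linear_injective_0)
         (auto intro: bounded_linear.linear blinfun.bounded_linear_right)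
  qed
  have "linear (blinfun_apply (F' x))"
    by (intro bounded_linear.linear blinfun.bounded_linear_right)
  from linear_injective_left_inverse[OF this inj] obtain G
    where G: "linear G" "G \<circ> blinfun_apply (F' x) = id" by blast
  have invG: "Blinfun G o\<^sub>L F' x = id_blinfun"
    using G by (intro blinfun_eqI)
      (simp add: bounded_linear_Blinfun_apply linear_conv_bounded_linear o_def fun_eq_iff)
  obtain U' V g g' where UV: "x \<in> U'" "open V" "F x \<in> V" "homeomorphism U' V F g"
    and derg: "\<And>z. z \<in> V \<Longrightarrow> (g has_derivative g' z) (at z)"
    and g': "\<And>z. z \<in> V \<Longrightarrow> g' z = inv (blinfun_apply (F' (g z)))"
    using inverse_function_theorem[OF W(1) derF contF' W(2) invG] by metis
  have gF: "g (F x) = x" and Fg: "\<And>z. z \<in> V \<Longrightarrow> F (g z) = z"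
    using UV by (auto simp: homeomorphism_def)
  define v where "v = blinfun_apply (F' x) d"
  define l where "l t = F x + t *\<^sub>R v" for t :: real
  have l0: "l 0 = F x" by (simp add: l_def)
  have "(l has_vector_derivative v) (at 0)"
    unfolding l_def by (auto intro!: derivative_eq_intros)
  moreover have "(g has_derivative g' (F x)) (at (l 0) within l ` UNIV)"
    using derg[OF UV(3)] unfolding l0 by (rule has_derivative_at_withinI)
  ultimately have "((g \<circ> l) has_vector_derivative g' (F x) v) (at 0)"
    by (rule vector_derivative_diff_chain_within)
  moreover have "g' (F x) v = d"
    unfolding g'[OF UV(3)] gF v_def by (rule inv_f_f[OF inj])
  ultimately have deriv: "((g \<circ> l) has_vector_derivative d) (at 0)" by simp
  have "(l \<longlongrightarrow> F x) (nhds 0)"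
    unfolding l_def by (auto intro!: tendsto_eq_intros filterlim_ident)
  then have "eventually (\<lambda>t. l t \<in> V) (nhds 0)"
    using UV(2,3) by (rule topological_tendstoD)
  then have "eventually (\<lambda>t. \<forall>b\<in>B. \<phi> b ((g \<circ> l) t) = \<phi> b x + t * (b \<bullet> d)) (nhds 0)"
  proof eventually_elim
    case (elim t)
    have "(\<Sum>b\<in>B. (\<phi> b (g (l t)) - \<phi> b x - t * (b \<bullet> d)) *\<^sub>R b) = F (g (l t)) - F x - t *\<^sub>R v"
      by (simp add: F_def v_def F'_x scaleR_diff_left sum_subtractf scaleR_sum_right)
    also have "\<dots> = 0"
      by (simp add: Fg[OF elim]) (simp add: l_def)
    finally have "\<forall>b\<in>B. \<phi> b (g (l t)) - \<phi> b x - t * (b \<bullet> d) = 0"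
      by (intro ballI independentD[OF indep finB subset_refl])
    then show ?case by (auto simp: algebra_simps)
  qed
  with deriv show thesis
    by (intro that[of "g \<circ> l"]) (simp_all add: l0 gF)
qed

lemma C1_at_inner: "C1_at (\<lambda>y. b \<bullet> y) x"
  and gradient_inner: "gradient (\<lambda>y. b \<bullet> y) x = b"
proof -
  have G: "GDERIV (\<lambda>y. b \<bullet> y) z :> b" for z
    unfolding gderiv_def by (auto intro!: derivative_eq_intros simp: inner_commute)
  then show "gradient (\<lambda>y. b \<bullet> y) x = b" by (rule gradient_eq)
  have "gradient (\<lambda>y. b \<bullet> y) = (\<lambda>_. b)" using G gradient_eq by blast
  moreover have "(\<lambda>y. b \<bullet> y) differentiable (at z)" for z
    using G[of z] unfolding gderiv_def by (rule differentiableI)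
  ultimately show "C1_at (\<lambda>y. b \<bullet> y) x"
    unfolding C1_at_def by (intro exI[of _ UNIV]) auto
qed

section \<open>Constraint qualifications straighten the active constraints\<close>

text \<open>The family indexed by a basis consists of the active constraints, each labelled by its
  gradient (legitimate since LICQ makes the labelling injective), and of linear functions for
  the remaining basis vectors.\<close>

lemma LICQ_imp_arc:
  fixes c :: "'i \<Rightarrow> 'a::euclidean_space \<Rightarrow> real"
  assumes licq: "LICQ c E I x"
    and C1: "\<And>i. i \<in> active_set c E I x \<Longrightarrow> C1_at (c i) x"
    and zero: "\<And>i. i \<in> active_set c E I x \<Longrightarrow> c i x = 0"
  obtains y :: "real \<Rightarrow> 'a"
  where "y 0 = x" and "(y has_vector_derivative d) (at 0)"
    and "eventually (\<lambda>t. \<forall>i\<in>active_set c E I x. c i (y t) = t * (gradient (c i) x \<bullet> d)) (nhds 0)"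
proof -
  let ?A = "active_set c E I x" and ?a = "\<lambda>i. gradient (c i) x"
  have inj: "inj_on ?a ?A" and ind: "independent (?a ` ?A)"
    using licq by (auto simp: LICQ_def)
  obtain B where B: "?a ` ?A \<subseteq> B" "independent B" "span B = UNIV"
    using maximal_independent_subset_extend[OF subset_UNIV ind] by (metis UNIV_eq_I UNIV_I subsetD)
  define \<phi> where "\<phi> b = (if b \<in> ?a ` ?A then c (the_inv_into ?A ?a b) else (\<lambda>y. b \<bullet> y))" for b
  have \<phi>_active: "\<phi> (?a i) = c i" if "i \<in> ?A" for i
    using that by (simp add: \<phi>_def the_inv_into_f_f[OF inj])
  have \<phi>: "C1_at (\<phi> b) x \<and> gradient (\<phi> b) x = b" for b
  proof (cases "b \<in> ?a ` ?A")
    case True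
    then show ?thesis using \<phi>_active C1 by force
  next
    case False
    then show ?thesis by (simp add: \<phi>_def C1_at_inner gradient_inner)
  qed
  obtain y where y: "y 0 = x" "(y has_vector_derivative d) (at 0)"
    and ev: "eventually (\<lambda>t. \<forall>b\<in>B. \<phi> b (y t) = \<phi> b x + t * (b \<bullet> d)) (nhds 0)"
    using exists_arc_with_linear_coordinates[of B \<phi> x d] B \<phi> by blast
  from ev have "eventually (\<lambda>t. \<forall>i\<in>?A. c i (y t) = t * (?a i \<bullet> d)) (nhds 0)"
  proof eventually_elim
    case (elim t)
    show ?case
    proof
      fix i assume i: "i \<in> ?A"
      then have "?a i \<in> B" using B(1) by blast
      then have "\<phi> (?a i) (y t) = \<phi> (?a i) x + t * (?a i \<bullet> d)" using elim by blast
      then show "c i (y t) = t * (?a i \<bullet> d)" using i by (simp add: \<phi>_active zero)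
    qed
  qed
  with y show thesis by (rule that)
qed

lemma linear_CQ_imp_arc:
  fixes c :: "'i \<Rightarrow> 'a::euclidean_space \<Rightarrow> real"
  assumes lin: "linear_CQ c E I x"
    and zero: "\<And>i. i \<in> active_set c E I x \<Longrightarrow> c i x = 0"
  obtains y :: "real \<Rightarrow> 'a"
  where "y 0 = x" and "(y has_vector_derivative d) (at 0)"
    and "eventually (\<lambda>t. \<forall>i\<in>active_set c E I x. c i (y t) = t * (gradient (c i) x \<bullet> d)) (nhds 0)"
proof -
  let ?y = "\<lambda>t. x + t *\<^sub>R d"
  have "c i (?y t) = t * (gradient (c i) x \<bullet> d)" if i: "i \<in> active_set c E I x" for i t
  proof -
    obtain a b where ab: "\<And>y. c i y = a \<bullet> y + b"
      using lin i unfolding linear_CQ_def by blast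
    then have c: "c i = (\<lambda>y. a \<bullet> y + b)" by auto
    have "GDERIV (c i) x :> a"
      unfolding gderiv_def c by (auto intro!: derivative_eq_intros simp: inner_commute)
    then have "gradient (c i) x = a" by (rule gradient_eq)
    moreover have "a \<bullet> x + b = 0" using zero[OF i] by (simp add: ab)
    ultimately show ?thesis by (simp add: ab inner_right_distrib)
  qed
  then have "eventually (\<lambda>t. \<forall>i\<in>active_set c E I x.
      c i (?y t) = t * (gradient (c i) x \<bullet> d)) (nhds 0)"
    by simp
  moreover have "(?y has_vector_derivative d) (at 0)"
    by (auto intro!: derivative_eq_intros)
  ultimately show thesis by (intro that[of ?y]) simp_all
qed

section \<open>First-order necessary conditions\<close>

lemma local_minimizer_gradient_along_arc:
  fixes f :: "'a::euclidean_space \<Rightarrow> real"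
  assumes min: "local_minimizer_on f S x" and diff: "f differentiable (at x)"
    and y0: "y 0 = x" and dery: "(y has_vector_derivative d) (at (0::real))"
    and feas: "eventually (\<lambda>t. y t \<in> S) (at_right 0)"
  shows "gradient f x \<bullet> d \<ge> 0"
proof (rule ccontr)
  assume "\<not> gradient f x \<bullet> d \<ge> 0"
  then have neg: "gradient f x \<bullet> d < 0" by simp
  obtain U where U: "open U" "x \<in> U" "\<And>z. z \<in> S \<inter> U \<Longrightarrow> f x \<le> f z"
    using min unfolding local_minimizer_on_def by blast
  have "(f has_derivative (\<lambda>h. h \<bullet> gradient f x)) (at (y 0) within y ` UNIV)"
    using gderiv_gradient[OF diff] unfolding gderiv_def y0 by (rule has_derivative_at_withinI)
  from vector_derivative_diff_chain_within[OF dery this]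
  have "(f \<circ> y has_real_derivative gradient f x \<bullet> d) (at 0)"
    by (simp add: has_real_derivative_iff_has_vector_derivative inner_commute)
  from DERIV_neg_dec_right[OF this neg]
  obtain e where e: "e > 0" "\<And>t. 0 < t \<Longrightarrow> t < e \<Longrightarrow> f (y t) < f x"
    by (auto simp: y0)
  then have "eventually (\<lambda>t. f (y t) < f x) (at_right 0)"
    unfolding eventually_at_right_field by blast
  moreover have "eventually (\<lambda>t. y t \<in> U) (at_right 0)"
  proof -
    have "isCont y 0" using dery by (rule has_vector_derivative_continuous)
    then have "(y \<longlongrightarrow> x) (at_right 0)"
      using y0 by (auto simp: isCont_def intro: filterlim_mono[OF _ order_refl at_le])
    then show ?thesis using U(1,2) by (rule topological_tendstoD)
  qed
  ultimately have "eventually (\<lambda>t::real. False) (at_right 0)"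
    using feas
  proof eventually_elim
    case (elim t)
    then show False using U(3)[of "y t"] by simp
  qed
  then show False by simp
qed

text \<open>Along the arc the active constraints have the sign of their linearizations, and the inactive
  ones stay positive near \<open>x\<close> by continuity.\<close>

lemma arc_feasible:
  fixes c :: "'i \<Rightarrow> 'a::euclidean_space \<Rightarrow> real"
  assumes fin: "finite I" and x: "x \<in> feasible_set c E I"
    and cont: "\<And>i. i \<in> I \<Longrightarrow> isCont (c i) x"
    and y0: "y 0 = x" and conty: "isCont y (0::real)"
    and arc: "eventually (\<lambda>t. \<forall>i\<in>active_set c E I x. c i (y t) = t * (gradient (c i) x \<bullet> d)) (nhds 0)"
    and dE: "\<And>i. i \<in> E \<Longrightarrow> gradient (c i) x \<bullet> d = 0"
    and dI: "\<And>i. i \<in> I \<Longrightarrow> c i x = 0 \<Longrightarrow> gradient (c i) x \<bullet> d \<ge> 0"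
  shows "eventually (\<lambda>t. y t \<in> feasible_set c E I) (at_right 0)"
proof -
  have "\<forall>i\<in>{i\<in>I. c i x > 0}. eventually (\<lambda>t. c i (y t) > 0) (at_right 0)"
  proof
    fix i assume i: "i \<in> {i\<in>I. c i x > 0}"
    then have "isCont (\<lambda>t. c i (y t)) 0"
      by (intro isCont_o2[OF conty]) (simp add: y0 cont)
    then have "((\<lambda>t. c i (y t)) \<longlongrightarrow> c i x) (at_right 0)"
      using y0 by (auto simp: isCont_def intro: filterlim_mono[OF _ order_refl at_le])
    then show "eventually (\<lambda>t. c i (y t) > 0) (at_right 0)"
      using i by (intro order_tendstoD) auto
  qed
  then have "eventually (\<lambda>t. \<forall>i\<in>{i\<in>I. c i x > 0}. c i (y t) > 0) (at_right 0)"
    using fin by (intro eventually_ball_finite) auto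
  moreover have "eventually (\<lambda>t. \<forall>i\<in>active_set c E I x.
      c i (y t) = t * (gradient (c i) x \<bullet> d)) (at_right 0)"
    using arc by (simp add: eventually_nhds_conv_at eventually_at_split)
  moreover have "eventually (\<lambda>t::real. t > 0) (at_right 0)"
    by (rule eventually_at_right_less)
  ultimately show ?thesis
  proof eventually_elim
    case (elim t)
    have "c i (y t) \<ge> 0" if "i \<in> I" for i
    proof (cases "c i x = 0")
      case True
      then show ?thesis using elim(2,3) dI that by (simp add: active_set_def)
    next
      case False
      then have "c i x > 0" using x that by (force simp: feasible_set_def)
      then show ?thesis using elim(1) that by force
    qed
    moreover have "c i (y t) = 0" if "i \<in> E" for i
      using elim(2) dE that by (simp add: active_set_def)
    ultimately show ?case by (simp add: feasible_set_def)
  qed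
qed

lemma GDERIV_lagrangian:
  assumes f: "GDERIV f x :> g"
    and c: "\<And>i. i \<in> E \<union> I \<Longrightarrow> GDERIV (c i) x :> a i"
  shows "GDERIV (\<lambda>x. lagrangian f c E I x lam mu) x :>
    g - (\<Sum>i\<in>E. lam i *\<^sub>R a i) - (\<Sum>i\<in>I. mu i *\<^sub>R a i)"
proof -
  have "((\<lambda>x. \<Sum>i\<in>T. w i * c i x) has_derivative (\<lambda>h. h \<bullet> (\<Sum>i\<in>T. w i *\<^sub>R a i))) (at x)"
    if "T \<subseteq> E \<union> I" for T and w :: "_ \<Rightarrow> real"
  proof -
    have "((\<lambda>x. \<Sum>i\<in>T. w i * c i x) has_derivative (\<lambda>h. \<Sum>i\<in>T. w i * (h \<bullet> a i))) (at x)"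
      using c that unfolding gderiv_def
      by (intro has_derivative_sum has_derivative_mult_right) auto
    then show ?thesis by (simp add: inner_sum_right)
  qed
  then show ?thesis
    using f unfolding lagrangian_def gderiv_def inner_diff_right
    by (intro has_derivative_diff) auto
qed

theorem theorem13:
  fixes f :: "real ^ 'n \<Rightarrow> real"
    and c :: "'i \<Rightarrow> real ^ 'n \<Rightarrow> real"
    and E I :: "'i set"
    and xs :: "real ^ 'n"
  assumes "finite E" and "finite I" and "E \<inter> I = {}"
    and "local_minimizer_on f (feasible_set c E I) xs"
    and "f differentiable (at xs)"
    and "\<forall>i\<in>E \<union> I. C1_at (c i) xs"
    and "LICQ c E I xs \<or> linear_CQ c E I xs"
  shows "\<exists>lam mu :: 'i \<Rightarrow> real.
    GDERIV (\<lambda>x. lagrangian f c E I x lam mu) xs :> 0 \<and>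
    (\<forall>i\<in>E. c i xs = 0) \<and>
    (\<forall>i\<in>I. c i xs \<ge> 0) \<and>
    (\<forall>i\<in>I. mu i \<ge> 0) \<and>
    (\<forall>i\<in>I. mu i * c i xs = 0)"
proof -
  let ?A = "active_set c E I xs" and ?a = "\<lambda>i. gradient (c i) xs"
  define J where "J = {i\<in>I. c i xs = 0}"
  have feas: "xs \<in> feasible_set c E I"
    using assms(4) by (simp add: local_minimizer_on_def)
  have zero: "c i xs = 0" if "i \<in> ?A" for i
    using that feas by (auto simp: active_set_def feasible_set_def)
  have sub: "?A \<subseteq> E \<union> I" by (auto simp: active_set_def)
  have diff: "c i differentiable (at xs)" if "i \<in> E \<union> I" for i
    using assms(6) that unfolding C1_at_def by blast
  have no_descent: "gradient f xs \<bullet> d \<ge> 0"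
    if d: "\<And>i. i \<in> E \<Longrightarrow> ?a i \<bullet> d = 0" "\<And>i. i \<in> J \<Longrightarrow> ?a i \<bullet> d \<ge> 0" for d
  proof -
    have "\<exists>y. y 0 = xs \<and> (y has_vector_derivative d) (at 0) \<and>
        eventually (\<lambda>t. \<forall>i\<in>?A. c i (y t) = t * (?a i \<bullet> d)) (nhds 0)"
      using assms(7)
    proof
      assume "LICQ c E I xs"
      then show ?thesis
        by (rule LICQ_imp_arc[where d = d]) (use assms(6) sub zero in auto)
    next
      assume "linear_CQ c E I xs"
      then show ?thesis
        by (rule linear_CQ_imp_arc[where d = d]) (use zero in auto)
    qed
    then obtain y where y: "y 0 = xs" "(y has_vector_derivative d) (at 0)"
      "eventually (\<lambda>t. \<forall>i\<in>?A. c i (y t) = t * (?a i \<bullet> d)) (nhds 0)" by blast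
    have "eventually (\<lambda>t. y t \<in> feasible_set c E I) (at_right 0)"
    proof (rule arc_feasible[OF assms(2) feas _ y(1) _ y(3) d(1)])
      show "isCont (c i) xs" if "i \<in> I" for i
        using diff that differentiable_imp_continuous_within by blast
      show "isCont y 0" using y(2) by (rule has_vector_derivative_continuous)
    qed (use d(2) in \<open>auto simp: J_def\<close>)
    then show ?thesis
      by (rule local_minimizer_gradient_along_arc[OF assms(4,5) y(1,2)])
  qed
  have "finite J" using assms(2) by (simp add: J_def)
  have "\<exists>lam m :: 'i \<Rightarrow> real. (\<forall>i\<in>J. m i \<ge> 0) \<and>
      gradient f xs = (\<Sum>i\<in>E. lam i *\<^sub>R ?a i) + (\<Sum>i\<in>J. m i *\<^sub>R ?a i)"
    by (rule farkas_mixed[OF assms(1) \<open>finite J\<close>]) (rule no_descent)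
  then obtain lam m :: "'i \<Rightarrow> real"
    where m: "\<forall>i\<in>J. m i \<ge> 0"
      and eq: "gradient f xs = (\<Sum>i\<in>E. lam i *\<^sub>R ?a i) + (\<Sum>i\<in>J. m i *\<^sub>R ?a i)"
    by (elim exE conjE)
  \<comment> \<open>zero off \<open>J\<close>: this is complementarity, and the sum over \<open>J\<close> extends to \<open>I\<close>\<close>
  define mu where "mu i = (if i \<in> J then m i else 0)" for i
  have "(\<Sum>i\<in>J. m i *\<^sub>R ?a i) = (\<Sum>i\<in>I. mu i *\<^sub>R ?a i)"
    using assms(2) by (intro sum.mono_neutral_cong_left) (auto simp: J_def mu_def)
  then have "gradient f xs - (\<Sum>i\<in>E. lam i *\<^sub>R ?a i) - (\<Sum>i\<in>I. mu i *\<^sub>R ?a i) = 0"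
    by (simp add: eq)
  then have "GDERIV (\<lambda>x. lagrangian f c E I x lam mu) xs :> 0"
    using GDERIV_lagrangian[OF gderiv_gradient[OF assms(5)] gderiv_gradient[OF diff],
        of E I "\<lambda>i. i" lam mu]
    by simp
  then show ?thesis
    using feas m by (intro exI[of _ lam] exI[of _ mu]) (auto simp: feasible_set_def mu_def J_def)
qed

end
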